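(* Let $n\ge1$, $t>0$ and $0\le q<1$. Let $V_n(t)=\{(x_1,\dots,x_n):x_1\in\{1,1+t\},\ x_i\in\{1,(1+t)x_{i-1}\}\ (2\le i\le n)\}$, and let $V_n(q,t)$ be obtained from $V_n(t)$ by replacing, in each point, the trailing $1$'s (the maximal final block of coordinates equal to $1$) by $1-q$. Then $V_n(q,t)$ is the set of vertices of the Tutte polytope $\mathbf{T}_n(q,t)$. In particular $\mathbf{T}_n(q,t)$ has $2^n$ vertices.
   Context: For $0<q\le1$ and $t>0$, $\mathbf{T}_n(q,t)$ is the set of $(x_1,\dots,x_n)\in\mathbb{R}^n$ with $x_n\ge1-q$ and $qx_i\le q(1+t)x_{i-1}-t(1-q)(1-x_{j-1})$ for all $1\le j\le i\le n$, where $x_0:=1$. For $q=0$, the paper's convention is that $\mathbf{T}_n(0,t)$ denotes the $t$-Cayley polytope $\mathbf{C}_n(t)=\{(x_1,\dots,x_n):1\le x_1\le1+t,\ 1\le x_i\le(1+t)x_{i-1}\ (2\le i\le n)\}$. *)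

theory Defs
  imports "HOL-Analysis.Analysis"
begin

text \<open>
  Points of Euclidean \<open>n\<close>-space are vectors \<open>x :: real ^ 'n\<close>. Since the index type \<open>'n\<close> carries no
  order, the definitions take an enumeration \<open>e\<close> of the coordinates, meant to satisfy
  \<open>bij_betw e {1..n} UNIV\<close>; the coordinate \<open>x\<^sub>i\<close> is \<open>x $ e i\<close> for \<open>1 \<le> i \<le> n\<close>.
\<close>

text \<open>The coordinate \<open>x\<^sub>i\<close> for \<open>0 \<le> i \<le> n\<close>, with the convention \<open>x\<^sub>0 = 1\<close>.\<close>

definition coord :: "(nat \<Rightarrow> 'n) \<Rightarrow> real ^ 'n \<Rightarrow> nat \<Rightarrow> real" where
  "coord e x i = (if i = 0 then 1 else x $ e i)"

definition cayley_polytope :: "nat \<Rightarrow> (nat \<Rightarrow> 'n) \<Rightarrow> real \<Rightarrow> (real ^ 'n) set" where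
  "cayley_polytope n e t =
     {x. 1 \<le> x $ e 1 \<and> x $ e 1 \<le> 1 + t \<and>
         (\<forall>i\<in>{2..n}. 1 \<le> x $ e i \<and> x $ e i \<le> (1 + t) * x $ e (i - 1))}"

text \<open>
  At \<open>q = 0\<close> the inequalities degenerate, and the Tutte polytope is by convention the Cayley polytope.
\<close>

definition tutte_polytope :: "nat \<Rightarrow> (nat \<Rightarrow> 'n) \<Rightarrow> real \<Rightarrow> real \<Rightarrow> (real ^ 'n) set" where
  "tutte_polytope n e q t =
     (if q = 0 then cayley_polytope n e t
      else {x. x $ e n \<ge> 1 - q \<and>
               (\<forall>i j. 1 \<le> j \<and> j \<le> i \<and> i \<le> n \<longrightarrow>
                  q * x $ e i
                    \<le> q * (1 + t) * coord e x (i - 1) - t * (1 - q) * (1 - coord e x (j - 1)))})"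

definition cayley_points :: "nat \<Rightarrow> (nat \<Rightarrow> 'n) \<Rightarrow> real \<Rightarrow> (real ^ 'n) set" where
  "cayley_points n e t =
     {x. x $ e 1 \<in> {1, 1 + t} \<and> (\<forall>i\<in>{2..n}. x $ e i \<in> {1, (1 + t) * x $ e (i - 1)})}"

text \<open>
  Replaces the trailing \<open>1\<close>'s by \<open>1 - q\<close>: the coordinate \<open>x $ k\<close>, where \<open>k = e i\<close>, belongs to the
  maximal final block of \<open>1\<close>'s iff all coordinates from \<open>x\<^sub>i\<close> up to \<open>x\<^sub>n\<close> equal \<open>1\<close>.
\<close>

definition replace_trailing_ones ::
    "nat \<Rightarrow> (nat \<Rightarrow> 'n) \<Rightarrow> real \<Rightarrow> real ^ 'n \<Rightarrow> real ^ ('n::finite)" where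
  "replace_trailing_ones n e q x =
     (\<chi> k. if \<exists>i\<in>{1..n}. e i = k \<and> (\<forall>l\<in>{i..n}. x $ e l = 1) then 1 - q else x $ k)"

definition tutte_points :: "nat \<Rightarrow> (nat \<Rightarrow> 'n::finite) \<Rightarrow> real \<Rightarrow> real \<Rightarrow> (real ^ 'n) set" where
  "tutte_points n e q t = replace_trailing_ones n e q ` cayley_points n e t"

end

theory Submission
  imports Defs
begin

text \<open>
  Write \<open>s = 1 + t\<close> and \<open>c = t (1 - q) / q\<close>.  The polytope is cut out by \<open>x\<^sub>i \<ge> 1 - q\<close> and
  \<open>x\<^sub>i \<le> s x\<^sub>i\<^sub>-\<^sub>1 - c (1 - m\<^sub>i\<^sub>-\<^sub>1)\<close>, where \<open>m\<^sub>i\<close> is the running minimum of \<open>x\<^sub>0, \<dots>, x\<^sub>i\<close>.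
  At a point of \<open>V\<^sub>n(q,t)\<close> enough of these inequalities are tight to determine the point, so it is
  extreme.  Conversely, let \<open>x\<close> be extreme.  The value \<open>1 - q\<close> is a repelling fixed point of
  \<open>x \<mapsto> s x - c (1 - x)\<close>, so a coordinate that attains its upper bound never becomes a new running
  minimum above \<open>1 - q\<close>.  Hence, if some coordinate stays below its upper bound and has a value
  \<open>v\<close> other than \<open>1\<close> and \<open>1 - q\<close>, then all such coordinates of value \<open>v\<close> can be moved
  simultaneously, while the coordinates at their upper bounds follow linearly.  This is impossible,
  so all coordinates are \<open>1\<close>, \<open>1 - q\<close> or at their upper bound.
\<close>

text \<open>A strict inequality survives small \<open>\<epsilon>\<close> by continuity, and an
  equality survives because the slopes agree. Hence only tight constraints restrict the directions
  in which a point of the polytope can move.\<close>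

lemma eventually_affine_le:
  fixes a b \<alpha> \<beta> :: real
  assumes "a \<le> b" and "a = b \<Longrightarrow> \<alpha> = \<beta>"
  shows "\<forall>\<^sub>F \<epsilon> in nhds 0. a + \<epsilon> * \<alpha> \<le> b + \<epsilon> * \<beta>"
proof (cases "a = b")
  case True
  then show ?thesis using assms(2) by simp
next
  case False
  have "((\<lambda>\<epsilon>. (b + \<epsilon> * \<beta>) - (a + \<epsilon> * \<alpha>)) \<longlongrightarrow> (b + 0 * \<beta>) - (a + 0 * \<alpha>)) (nhds 0)"
    by (intro tendsto_intros filterlim_ident)
  moreover have "0 < (b + 0 * \<beta>) - (a + 0 * \<alpha>)"
    using False assms(1) by simp
  ultimately have "\<forall>\<^sub>F \<epsilon> in nhds 0. 0 < (b + \<epsilon> * \<beta>) - (a + \<epsilon> * \<alpha>)"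
    by (rule order_tendstoD(1))
  then show ?thesis by (rule eventually_mono) simp
qed

text \<open>The weighted excesses of \<open>a\<close> and \<open>b\<close> over \<open>g\<close> are
  nonnegative and sum to \<open>0\<close>. Applied to slacks, this makes a constraint that is tight
  inside a segment tight at an endpoint.\<close>

lemma convex_combination_eq_lower_bound:
  fixes a b g u :: real
  assumes "0 < u" "u < 1" "g = (1 - u) * a + u * b" "g \<le> a" "g \<le> b"
  shows "a = g"
proof -
  have "(1 - u) * (a - g) + u * (b - g) = 0"
    using assms(3) by (simp add: algebra_simps)
  moreover have "0 \<le> (1 - u) * (a - g)" "0 \<le> u * (b - g)"
    using assms by auto
  ultimately have "(1 - u) * (a - g) = 0" by linarith
  then show ?thesis using assms(2) by simp
qed

text \<open>Since \<open>c \<ge> 0\<close>, the upper bounds for all \<open>j \<le> i\<close> amount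
  to the single one at the minimum. Index \<open>0\<close> is included, so for
  \<open>coord e x\<close> the minimum is at most \<open>1\<close>.\<close>

definition running_min :: "(nat \<Rightarrow> real) \<Rightarrow> nat \<Rightarrow> real" where
  "running_min X i = Min (X ` {..i})"

lemma running_min_le: "j \<le> i \<Longrightarrow> running_min X i \<le> X j"
  by (simp add: running_min_def)

lemma running_min_greatest: "(\<And>j. j \<le> i \<Longrightarrow> a \<le> X j) \<Longrightarrow> a \<le> running_min X i"
  by (simp add: running_min_def)

lemma running_min_attained: obtains j where "j \<le> i" "running_min X i = X j"
proof -
  have "running_min X i \<in> X ` {..i}"
    unfolding running_min_def by (rule Min_in) auto
  then show ?thesis using that by auto
qed

text \<open>
  The derivative of the sequence \<open>X\<close> when all terms of value \<open>v\<close> below their upper bound move with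
  unit speed and the terms at their upper bound follow it.
\<close>

primrec level_direction :: "real \<Rightarrow> real \<Rightarrow> real \<Rightarrow> (nat \<Rightarrow> real) \<Rightarrow> nat \<Rightarrow> real" where
  "level_direction s c v X 0 = 0"
| "level_direction s c v X (Suc i) =
     (if X (Suc i) = s * X i - c * (1 - running_min X i)
      then s * level_direction s c v X i + c * of_bool (running_min X i = v)
      else of_bool (X (Suc i) = v))"

section \<open>Coordinates, and uniform descriptions of the Cayley points and the polytope\<close>

lemma coord_0 [simp]: "coord e x 0 = 1"
  by (simp add: coord_def)

lemma coord_pos: "i \<ge> 1 \<Longrightarrow> coord e x i = x $ e i"
  by (simp add: coord_def)

lemma coord_Suc [simp]: "coord e x (Suc i) = x $ e (Suc i)"
  by (simp add: coord_def)

lemma coord_convex_combination: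
  "coord e ((1 - u) *\<^sub>R a + u *\<^sub>R b) i = (1 - u) * coord e a i + u * coord e b i"
  by (simp add: coord_def)

locale tutte_parameters =
  fixes n :: nat and e :: "nat \<Rightarrow> 'n::finite" and q t s c :: real
  assumes n_ge_1: "n \<ge> 1"
    and bij_e: "bij_betw e {1..n} (UNIV :: 'n set)"
    and t_pos: "t > 0" and q_ge_0: "0 \<le> q" and q_less_1: "q < 1"
    and s_eq: "s = 1 + t"
    and c_eq: "c = t * (1 - q) / q" \<comment> \<open>so that \<open>c = 0\<close> if \<open>q = 0\<close>\<close>
begin

lemma s_gt_1: "s > 1"
  using t_pos s_eq by simp

lemma c_ge_0: "c \<ge> 0"
  using t_pos q_ge_0 q_less_1 c_eq by simp

lemma c_pos: "q > 0 \<Longrightarrow> c > 0"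
  using t_pos q_less_1 c_eq by simp

lemma c_mult_q: "q > 0 \<Longrightarrow> c * q = t * (1 - q)"
  by (simp add: c_eq)

lemma vec_eq_coordI:
  assumes "\<And>i. 1 \<le> i \<Longrightarrow> i \<le> n \<Longrightarrow> coord e x i = coord e y i"
  shows "x = y"
proof (rule vec_eq_iff[THEN iffD2], rule allI)
  fix k :: 'n
  obtain i where "i \<in> {1..n}" "k = e i"
    using bij_e by (metis UNIV_I bij_betw_iff_bijections)
  then show "x $ k = y $ k" using assms[of i] by (simp add: coord_def)
qed

definition vec_of_seq :: "(nat \<Rightarrow> real) \<Rightarrow> real ^ 'n" where
  "vec_of_seq f = (\<chi> k. f (the_inv_into {1..n} e k))"

lemma coord_vec_of_seq:
  assumes "1 \<le> i" "i \<le> n"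
  shows "coord e (vec_of_seq f) i = f i"
proof -
  have "the_inv_into {1..n} e (e i) = i"
    using bij_e assms by (intro the_inv_into_f_f) (auto simp: bij_betw_def)
  then show ?thesis using assms by (simp add: coord_def vec_of_seq_def)
qed

text \<open>The convention \<open>coord e x 0 = 1\<close> absorbs the separate condition on the
  first coordinate, as \<open>1 + t\<close> is \<open>s\<close> times the coordinate before
  it.\<close>

lemma cayley_points_iff:
  "x \<in> cayley_points n e t \<longleftrightarrow>
     (\<forall>i<n. coord e x (Suc i) = 1 \<or> coord e x (Suc i) = s * coord e x i)"
proof
  assume x: "x \<in> cayley_points n e t"
  show "\<forall>i<n. coord e x (Suc i) = 1 \<or> coord e x (Suc i) = s * coord e x i"
  proof (intro allI impI)
    fix i assume "i < n"
    then show "coord e x (Suc i) = 1 \<or> coord e x (Suc i) = s * coord e x i"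
      using x by (cases i) (auto simp: cayley_points_def s_eq)
  qed
next
  assume *: "\<forall>i<n. coord e x (Suc i) = 1 \<or> coord e x (Suc i) = s * coord e x i"
  have "x $ e i = 1 \<or> x $ e i = (1 + t) * x $ e (i - 1)" if "i \<in> {2..n}" for i
    using *[rule_format, of "i - 1"] that by (auto simp: coord_def s_eq)
  moreover have "x $ e 1 = 1 \<or> x $ e 1 = 1 + t"
    using *[rule_format, of 0] n_ge_1 by (auto simp: s_eq)
  ultimately show "x \<in> cayley_points n e t"
    by (simp add: cayley_points_def)
qed

lemma cayley_points_ge_1:
  assumes "x \<in> cayley_points n e t" "i \<le> n"
  shows "coord e x i \<ge> 1"
  using assms(2)
proof (induction i)
  case (Suc i)
  then have ge: "coord e x i \<ge> 1" by simp
  have "1 * 1 \<le> s * coord e x i"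
    using ge s_gt_1 by (intro mult_mono) auto
  then show ?case
    using assms(1) Suc.prems unfolding cayley_points_iff by (metis Suc_le_lessD mult_1 order_refl)
qed simp

lemma coord_replace_trailing_ones:
  assumes "1 \<le> i" "i \<le> n"
  shows "coord e (replace_trailing_ones n e q x) i =
           (if \<forall>l\<in>{i..n}. coord e x l = 1 then 1 - q else coord e x i)"
proof -
  have "(\<exists>i'\<in>{1..n}. e i' = e i \<and> (\<forall>l\<in>{i'..n}. x $ e l = 1)) \<longleftrightarrow> (\<forall>l\<in>{i..n}. x $ e l = 1)"
    using bij_e assms unfolding bij_betw_def inj_on_def
    by (metis atLeastAtMost_iff)
  moreover have "(\<forall>l\<in>{i..n}. coord e x l = 1) \<longleftrightarrow> (\<forall>l\<in>{i..n}. x $ e l = 1)"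
    using assms by (auto simp: coord_def)
  ultimately show ?thesis
    using assms by (simp add: replace_trailing_ones_def coord_pos)
qed

text \<open>One description serves both cases of the definition: for \<open>q > 0\<close> the
  inequalities are divided by \<open>q\<close>, and for \<open>q = 0\<close> the term with
  \<open>c\<close> vanishes and the Cayley inequalities remain.\<close>

lemma tutte_polytope_iff:
  "x \<in> tutte_polytope n e q t \<longleftrightarrow>
     (\<forall>i\<in>{1..n}. 1 - q \<le> coord e x i) \<and>
     (\<forall>i<n. \<forall>j\<le>i. coord e x (Suc i) \<le> s * coord e x i - c * (1 - coord e x j))"
proof (cases "q = 0")
  case True
  have "x \<in> cayley_polytope n e t \<longleftrightarrow>
     (\<forall>i\<in>{1..n}. 1 \<le> coord e x i) \<and> (\<forall>i<n. coord e x (Suc i) \<le> s * coord e x i)" (is "_ \<longleftrightarrow> ?R")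
  proof
    assume x: "x \<in> cayley_polytope n e t"
    have "1 \<le> coord e x i" if "i \<in> {1..n}" for i
      using x that by (cases "i = 1") (auto simp: cayley_polytope_def coord_def)
    moreover have "coord e x (Suc i) \<le> s * coord e x i" if "i < n" for i
    proof (cases i)
      case (Suc j)
      then have "Suc i \<in> {2..n}" using that by auto
      then have "x $ e (Suc i) \<le> (1 + t) * x $ e (Suc i - 1)"
        using x unfolding cayley_polytope_def by blast
      then show ?thesis using Suc by (simp add: s_eq)
    qed (use x in \<open>auto simp: cayley_polytope_def s_eq\<close>)
    ultimately show ?R by blast
  next
    assume R: ?R
    have "1 \<le> x $ e i" "x $ e i \<le> (1 + t) * x $ e (i - 1)" if "i \<in> {2..n}" for i
      using R[THEN conjunct1, rule_format, of i] R[THEN conjunct2, rule_format, of "i - 1"] that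
      by (auto simp: coord_def s_eq)
    moreover have "1 \<le> x $ e 1" "x $ e 1 \<le> 1 + t"
      using R[THEN conjunct1, rule_format, of 1] R[THEN conjunct2, rule_format, of 0] n_ge_1
      by (auto simp: coord_def s_eq)
    ultimately show "x \<in> cayley_polytope n e t"
      by (simp add: cayley_polytope_def)
  qed
  then show ?thesis
    using True by (auto simp: tutte_polytope_def c_eq)
next
  case False
  then have q: "q > 0" using q_ge_0 by simp
  let ?X = "coord e x"
  have ineq: "q * a \<le> q * (1 + t) * b - t * (1 - q) * d \<longleftrightarrow> a \<le> s * b - c * d" for a b d
  proof -
    have "q * (1 + t) * b - t * (1 - q) * d = q * (s * b - c * d)"
      using q by (simp add: s_eq c_eq field_simps)
    then show ?thesis using q by simp
  qed
  have bounds: "x \<in> tutte_polytope n e q t \<longleftrightarrow> 1 - q \<le> ?X n \<and>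
     (\<forall>i<n. \<forall>j\<le>i. ?X (Suc i) \<le> s * ?X i - c * (1 - ?X j))"
  proof -
    have "x \<in> tutte_polytope n e q t \<longleftrightarrow> 1 - q \<le> ?X n \<and>
       (\<forall>i j. 1 \<le> j \<and> j \<le> i \<and> i \<le> n \<longrightarrow> ?X i \<le> s * ?X (i - 1) - c * (1 - ?X (j - 1)))"
      using False n_ge_1 by (auto simp: tutte_polytope_def ineq coord_pos)
    also have "(\<forall>i j. 1 \<le> j \<and> j \<le> i \<and> i \<le> n \<longrightarrow> ?X i \<le> s * ?X (i - 1) - c * (1 - ?X (j - 1)))
       \<longleftrightarrow> (\<forall>i<n. \<forall>j\<le>i. ?X (Suc i) \<le> s * ?X i - c * (1 - ?X j))" (is "?L \<longleftrightarrow> ?R")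
    proof
      assume L: ?L
      show ?R
      proof (intro allI impI)
        fix i j assume "i < n" "j \<le> i"
        then show "?X (Suc i) \<le> s * ?X i - c * (1 - ?X j)"
          using L[rule_format, of "Suc j" "Suc i"] by simp
      qed
    next
      assume R: ?R
      show ?L
      proof (intro allI impI)
        fix i j assume "1 \<le> j \<and> j \<le> i \<and> i \<le> n"
        moreover from this have "i - 1 < n" "j - 1 \<le> i - 1" "Suc (i - 1) = i" by auto
        ultimately show "?X i \<le> s * ?X (i - 1) - c * (1 - ?X (j - 1))"
          using R by metis
      qed
    qed
    finally show ?thesis .
  qed
  \<comment> \<open>The definition bounds only the last coordinate from below. The bound descends
    from \<open>n\<close>, because the constraint with \<open>j = i\<close> says that the excess
    over \<open>1 - q\<close> grows at most by the factor \<open>s + c\<close>.\<close>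
  have "1 - q \<le> ?X i"
    if "1 - q \<le> ?X n" and *: "\<And>i j. i < n \<Longrightarrow> j \<le> i \<Longrightarrow> ?X (Suc i) \<le> s * ?X i - c * (1 - ?X j)"
      and "i \<le> n" for i
    using \<open>i \<le> n\<close>
  proof (induction rule: inc_induct)
    case base
    show ?case by fact
  next
    case (step i)
    have "1 - q \<le> s * ?X i - c * (1 - ?X i)"
      using step *[of i i] by simp
    then have "0 \<le> (s + c) * (?X i - (1 - q))"
      using c_mult_q[OF q] by (simp add: s_eq algebra_simps)
    then show ?case
      using s_gt_1 c_ge_0 by (simp add: zero_le_mult_iff)
  qed
  then show ?thesis
    using n_ge_1 unfolding bounds by auto
qed

lemma tutte_polytope_lower:
  assumes "x \<in> tutte_polytope n e q t" "i \<le> n"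
  shows "1 - q \<le> coord e x i"
proof (cases i)
  case 0
  then show ?thesis using q_ge_0 by simp
next
  case (Suc j)
  then show ?thesis using assms unfolding tutte_polytope_iff by (metis atLeastAtMost_iff le_add1 plus_1_eq_Suc)
qed

lemma tutte_polytope_upper:
  "x \<in> tutte_polytope n e q t \<Longrightarrow> i < n \<Longrightarrow> j \<le> i \<Longrightarrow>
     coord e x (Suc i) \<le> s * coord e x i - c * (1 - coord e x j)"
  by (simp add: tutte_polytope_iff)

subsection \<open>The points are extreme\<close>

text \<open>If \<open>i\<close> lies in the trailing block, then
  \<open>c * (1 - ?V j) \<le> c * q = t * (1 - q)\<close> suffices for \<open>q > 0\<close>.
  Otherwise the coordinates up to \<open>i\<close> are unchanged and at least \<open>1\<close>, so
  the term with \<open>c\<close> only weakens the bound \<open>s * ?Y i\<close>.\<close>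

lemma tutte_points_in_polytope:
  assumes x: "x \<in> cayley_points n e t"
  shows "replace_trailing_ones n e q x \<in> tutte_polytope n e q t"
proof -
  let ?Y = "coord e x" and ?V = "coord e (replace_trailing_ones n e q x)"
  have Y1: "?Y i \<ge> 1" if "i \<le> n" for i
    using cayley_points_ge_1[OF x that] .
  have low: "1 - q \<le> ?V i" if "i \<le> n" for i
    using Y1[OF that] q_ge_0 that by (cases "i = 0") (auto simp: coord_replace_trailing_ones)
  have "?V (Suc i) \<le> s * ?V i - c * (1 - ?V j)" if i: "i < n" and j: "j \<le> i" for i j
  proof (cases "1 \<le> i \<and> (\<forall>l\<in>{i..n}. ?Y l = 1)")
    case True
    then have "?V i = 1 - q" "?V (Suc i) = 1 - q"
      using i coord_replace_trailing_ones[of i x] coord_replace_trailing_ones[of "Suc i" x] by auto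
    moreover have "1 - q \<le> s * (1 - q) - c * (1 - ?V j)"
    proof (cases "q = 0")
      case True
      then show ?thesis using s_gt_1 by (simp add: c_eq)
    next
      case False
      then have "c * q = t * (1 - q)"
        using q_ge_0 c_mult_q by simp
      moreover have "c * (1 - ?V j) \<le> c * q"
        using low[of j] i j c_ge_0 by (intro mult_left_mono) auto
      ultimately show ?thesis by (simp add: s_eq algebra_simps)
    qed
    ultimately show ?thesis by simp
  next
    case False
    have V: "?V k = ?Y k" if "k \<le> i" for k
    proof (cases "k = 0")
      case k: False
      have "\<not> (\<forall>l\<in>{k..n}. ?Y l = 1)"
        using False that k by (metis One_nat_def Suc_leI atLeastAtMost_iff le_trans neq0_conv)
      then show ?thesis
        using coord_replace_trailing_ones[of k x] k that i by (simp only: if_False)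
    qed simp
    have "?V (Suc i) \<le> ?Y (Suc i)"
      using coord_replace_trailing_ones[of "Suc i" x] i Y1[of "Suc i"] q_ge_0 by simp
    also have "\<dots> \<le> s * ?Y i"
    proof -
      have "1 * 1 \<le> s * ?Y i"
        using Y1[of i] i s_gt_1 by (intro mult_mono) auto
      then show ?thesis using x i unfolding cayley_points_iff by fastforce
    qed
    also have "\<dots> \<le> s * ?Y i - c * (1 - ?Y j)"
      using c_ge_0 Y1[of j] i j by (simp add: mult_le_0_iff)
    finally show ?thesis using V j by simp
  qed
  then show ?thesis using low by (simp add: tutte_polytope_iff)
qed

text \<open>Constraints tight at the point stay tight at the endpoint \<open>a\<close> of a segment
  through it. By induction they determine all coordinates of \<open>a\<close>: a value
  \<open>1 - q\<close> by the lower bound, a value \<open>s\<close> times its predecessor by the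
  upper bound with \<open>j = 0\<close>, and a \<open>1\<close> outside the trailing block by two
  later tight bounds.\<close>

lemma tutte_points_extreme:
  assumes x: "x \<in> cayley_points n e t"
  shows "replace_trailing_ones n e q x extreme_point_of tutte_polytope n e q t"
  unfolding extreme_point_of_def
proof (intro conjI ballI notI)
  show "replace_trailing_ones n e q x \<in> tutte_polytope n e q t"
    using tutte_points_in_polytope[OF x] .
next
  fix a b
  let ?v = "replace_trailing_ones n e q x"
  let ?Y = "coord e x" and ?V = "coord e ?v" and ?A = "coord e a" and ?B = "coord e b"
  assume a: "a \<in> tutte_polytope n e q t" and b: "b \<in> tutte_polytope n e q t"
    and v: "?v \<in> open_segment a b"
  then obtain u where u: "0 < u" "u < 1" and veq: "?v = (1 - u) *\<^sub>R a + u *\<^sub>R b"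
    by (auto simp: in_segment)
  have V: "?V i = (1 - u) * ?A i + u * ?B i" for i
    unfolding veq by (rule coord_convex_combination)
  have tight_low: "?A i = 1 - q" if "i \<le> n" "?V i = 1 - q" for i
    using convex_combination_eq_lower_bound[OF u V[of i]] that
      tutte_polytope_lower[OF a] tutte_polytope_lower[OF b] by simp
  have tight_up: "?A (Suc i) = s * ?A i - c * (1 - ?A j)"
    if ij: "i < n" "j \<le> i" and eq: "?V (Suc i) = s * ?V i - c * (1 - ?V j)" for i j
  proof -
    \<comment> \<open>The slack is affine in \<open>X\<close>, nonnegative at both endpoints and
      zero at \<open>?v\<close>.\<close>
    let ?S = "\<lambda>X. s * X i - c * (1 - X j) - X (Suc i)"
    have "?S ?V = (1 - u) * ?S ?A + u * ?S ?B"
      unfolding V by (simp add: algebra_simps)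
    then have "?S ?A = ?S ?V"
      using convex_combination_eq_lower_bound[OF u, of "?S ?V" "?S ?A" "?S ?B"] eq
        tutte_polytope_upper[OF a ij] tutte_polytope_upper[OF b ij] by simp
    then show ?thesis using eq by simp
  qed
  have not_trailing: "?V k = ?Y k" if "l \<in> {k..n}" "?Y l \<noteq> 1" for k l
  proof (cases "k = 0")
    case False
    then show ?thesis using that coord_replace_trailing_ones[of k x] by auto
  qed simp
  have "?A i = ?V i" if "i \<le> n" for i
    using that
  proof (induction i)
    case (Suc i)
    then have i: "i < n" and IH: "?A i = ?V i" by auto
    show ?case
    proof (cases "?V (Suc i) = 1 - q")
      case True
      then show ?thesis using tight_low[of "Suc i"] i by simp
    next
      case False
      then obtain l where l: "l \<in> {Suc i..n}" "?Y l \<noteq> 1"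
        using coord_replace_trailing_ones[of "Suc i" x] i
        by (cases "\<forall>l\<in>{Suc i..n}. ?Y l = 1") (auto simp del: coord_Suc)
      have Vi: "?V (Suc i) = ?Y (Suc i)" "?V i = ?Y i"
        using not_trailing[of l "Suc i"] not_trailing[of l i] l by auto
      show ?thesis
      proof (cases "?Y (Suc i) = 1")
        case False
        then have "?V (Suc i) = s * ?V i - c * (1 - ?V 0)"
          using x i Vi unfolding cayley_points_iff by auto
        then show ?thesis using tight_up[of i 0] i IH by simp
      next
        case True
        then have "q \<noteq> 0"
          using False Vi by auto
        \<comment> \<open>Let \<open>k = Suc k'\<close> be the first later position whose value is
          not \<open>1\<close>. Since \<open>?V 0\<close> and \<open>?V (Suc i)\<close> are both
          \<open>1\<close>, the upper bounds at \<open>k\<close> with \<open>j = 0\<close> and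
          \<open>j = Suc i\<close> are both tight; comparing them at \<open>a\<close> fixes
          \<open>?A (Suc i)\<close>, as \<open>c > 0\<close>.\<close>
        define P where "P m \<longleftrightarrow> Suc i \<le> m \<and> ?Y m \<noteq> 1" for m
        define k where "k = (LEAST m. P m)"
        have Pl: "P l" using l by (simp add: P_def del: coord_Suc)
        have k: "P k" and kl: "k \<le> l"
          unfolding k_def using Pl by (rule LeastI, rule Least_le)
        have "k \<noteq> Suc i" using k True by (auto simp: P_def)
        then obtain k' where k': "k = Suc k'" "Suc i \<le> k'"
          using k by (cases k) (auto simp: P_def)
        have "?Y k' = 1"
          using not_less_Least[of k' P] k' unfolding k_def[symmetric] by (simp add: P_def)
        moreover have kn: "k' < n" using kl k' l by auto
        moreover have "?Y (Suc k') = s * ?Y k'"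
          using x k k' kn unfolding cayley_points_iff P_def by blast
        moreover have "?V k' = ?Y k'" "?V (Suc k') = ?Y (Suc k')"
          using not_trailing[of l k'] not_trailing[of l "Suc k'"] l kl k' by auto
        ultimately have "?V (Suc k') = s * ?V k'" by simp
        then have "?A (Suc k') = s * ?A k' - c * (1 - ?A 0)"
          "?A (Suc k') = s * ?A k' - c * (1 - ?A (Suc i))"
          using True Vi k' kn tight_up[of k' 0] tight_up[of k' "Suc i"]
          by (simp_all del: coord_Suc)
        then have "c * (1 - ?A (Suc i)) = 0" by simp
        then show ?thesis
          using c_pos \<open>q \<noteq> 0\<close> q_ge_0 True Vi by simp
      qed
    qed
  qed simp
  then have "a = ?v" by (intro vec_eq_coordI) auto
  then show False using v by (simp add: open_segment_def)
qed

subsection \<open>The extreme points are of the given form\<close>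

text \<open>The assumptions say that moving along \<open>d\<close> keeps every tight constraint
  tight. Small steps in both directions therefore stay in the polytope, and \<open>x\<close> would
  be the midpoint of a proper segment if \<open>d\<close> were nonzero.\<close>

lemma extreme_point_rigid:
  assumes x: "x extreme_point_of tutte_polytope n e q t"
    and low: "\<And>i. 1 \<le> i \<Longrightarrow> i \<le> n \<Longrightarrow> coord e x i = 1 - q \<Longrightarrow> d i = 0"
    and up: "\<And>i j. i < n \<Longrightarrow> j \<le> i \<Longrightarrow> coord e x (Suc i) = s * coord e x i - c * (1 - coord e x j) \<Longrightarrow>
               d (Suc i) = s * d i + c * d j"
    and d0: "d 0 = 0"
    and k: "1 \<le> k" "k \<le> n"
  shows "d k = 0"
proof (rule ccontr)
  assume dk: "d k \<noteq> 0"
  let ?X = "coord e x" and ?w = "vec_of_seq d"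
  have xT: "x \<in> tutte_polytope n e q t"
    using x by (simp add: extreme_point_of_def)
  have shift: "coord e (x + \<epsilon> *\<^sub>R ?w) i = ?X i + \<epsilon> * d i" if "i \<le> n" for i \<epsilon>
    using coord_vec_of_seq[of i d] that d0 by (cases "i = 0") (auto simp: coord_def)
  have "\<forall>\<^sub>F \<epsilon> in nhds 0. x + \<epsilon> *\<^sub>R ?w \<in> tutte_polytope n e q t"
  proof -
    have "\<forall>\<^sub>F \<epsilon> in nhds 0. \<forall>i\<in>{1..n}. (1 - q) + \<epsilon> * 0 \<le> ?X i + \<epsilon> * d i"
      using low tutte_polytope_lower[OF xT]
      by (intro eventually_ball_finite ballI eventually_affine_le) (auto simp del: coord_Suc)
    moreover have "\<forall>\<^sub>F \<epsilon> in nhds 0. \<forall>i\<in>{..<n}. \<forall>j\<in>{..i}.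
        ?X (Suc i) + \<epsilon> * d (Suc i) \<le> (s * ?X i - c * (1 - ?X j)) + \<epsilon> * (s * d i + c * d j)"
      using up tutte_polytope_upper[OF xT]
      by (intro eventually_ball_finite ballI eventually_affine_le) (auto simp del: coord_Suc)
    ultimately show ?thesis
    proof eventually_elim
      case (elim \<epsilon>)
      show ?case
        unfolding tutte_polytope_iff
      proof (intro conjI ballI allI impI)
        fix i assume "i \<in> {1..n}"
        then show "1 - q \<le> coord e (x + \<epsilon> *\<^sub>R ?w) i"
          using elim(1) by (simp add: shift)
      next
        fix i j assume ij: "i < n" "j \<le> i"
        then have "?X (Suc i) + \<epsilon> * d (Suc i)
            \<le> (s * ?X i - c * (1 - ?X j)) + \<epsilon> * (s * d i + c * d j)"
          using elim(2) by (simp del: coord_Suc)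
        also have "\<dots> = s * (?X i + \<epsilon> * d i) - c * (1 - (?X j + \<epsilon> * d j))"
          by (simp add: algebra_simps)
        finally show "coord e (x + \<epsilon> *\<^sub>R ?w) (Suc i)
            \<le> s * coord e (x + \<epsilon> *\<^sub>R ?w) i - c * (1 - coord e (x + \<epsilon> *\<^sub>R ?w) j)"
          using ij by (simp add: shift del: coord_Suc)
      qed
    qed
  qed
  then obtain \<delta> where \<delta>: "\<delta> > 0" "\<And>\<epsilon>. dist \<epsilon> 0 < \<delta> \<Longrightarrow> x + \<epsilon> *\<^sub>R ?w \<in> tutte_polytope n e q t"
    unfolding eventually_nhds_metric by blast
  define a where "a = x + (- \<delta> / 2) *\<^sub>R ?w"
  define b where "b = x + (\<delta> / 2) *\<^sub>R ?w"
  have "a \<in> tutte_polytope n e q t" "b \<in> tutte_polytope n e q t"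
    using \<delta>(2)[of "- \<delta> / 2"] \<delta>(2)[of "\<delta> / 2"] \<delta>(1)
    by (simp_all add: a_def b_def dist_real_def)
  moreover have "coord e a k \<noteq> coord e b k"
    unfolding a_def b_def shift[OF k(2)] using \<delta>(1) dk by simp
  then have "a \<noteq> b" by auto
  then have "midpoint a b \<in> open_segment a b" by simp
  moreover have "midpoint a b = x"
    unfolding a_def b_def midpoint_def by (simp add: vec_eq_iff)
  ultimately show False
    using x unfolding extreme_point_of_def by metis
qed

text \<open>For \<open>q > 0\<close> the value \<open>1 - q\<close> is fixed by the upper bound with
  \<open>j = l\<close>, so upper and lower bound on the next coordinate coincide.\<close>

lemma fixed_point_absorbing:
  assumes xT: "x \<in> tutte_polytope n e q t" and q: "q > 0"
    and "coord e x i = 1 - q" "i \<le> l" "l \<le> n"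
  shows "coord e x l = 1 - q"
  using \<open>i \<le> l\<close> \<open>l \<le> n\<close>
proof (induction rule: dec_induct)
  case base
  show ?case by fact
next
  case (step l)
  then have eq: "coord e x l = 1 - q" by simp
  have "coord e x (Suc l) \<le> s * coord e x l - c * (1 - coord e x l)"
    using tutte_polytope_upper[OF xT, of l l] step by simp
  also have "\<dots> = s * (1 - q) - c * q" unfolding eq by simp
  also have "\<dots> = 1 - q"
    unfolding c_mult_q[OF q] s_eq by (simp add: algebra_simps)
  finally show ?case
    using tutte_polytope_lower[OF xT step.prems] by linarith
qed

lemma extreme_point_slack_values:
  assumes x: "x extreme_point_of tutte_polytope n e q t" and k: "k < n"
    and slack: "coord e x (Suc k) \<noteq> s * coord e x k - c * (1 - running_min (coord e x) k)"
  shows "coord e x (Suc k) = 1 \<or> coord e x (Suc k) = 1 - q"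
proof (rule ccontr)
  let ?X = "coord e x"
  define v where "v = ?X (Suc k)"
  define d where "d = level_direction s c v ?X"
  define m where "m = running_min ?X"
  assume "\<not> ?thesis"
  then have v: "v \<noteq> 1" "v \<noteq> 1 - q" by (auto simp: v_def)
  have xT: "x \<in> tutte_polytope n e q t"
    using x by (simp add: extreme_point_of_def)
  have d_Suc: "d (Suc i) = (if ?X (Suc i) = s * ?X i - c * (1 - m i)
      then s * d i + c * of_bool (m i = v) else of_bool (?X (Suc i) = v))" for i
    unfolding d_def m_def by (simp del: coord_Suc)
  have m_low: "1 - q \<le> m i" if "i \<le> n" for i
    unfolding m_def using that tutte_polytope_lower[OF xT] by (intro running_min_greatest) auto
  have m_le: "m i \<le> ?X j" if "j \<le> i" for i j
    unfolding m_def using that by (rule running_min_le)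
  have upper: "?X (Suc i) \<le> s * ?X i - c * (1 - m i)" if "i < n" for i
    using running_min_attained[of i ?X] tutte_polytope_upper[OF xT that] unfolding m_def
    by metis
  \<comment> \<open>If a coordinate equal to \<open>1 - q\<close> is at its upper bound, the
    excesses of \<open>?X i\<close> and \<open>m i\<close> over \<open>1 - q\<close>, weighted by
    \<open>s\<close> and \<open>c\<close>, sum to \<open>0\<close>; for \<open>q > 0\<close> both
    vanish and induction applies. For \<open>q = 0\<close> this would require
    \<open>1 = s * ?X i \<ge> s\<close>.\<close>
  have low: "d i = 0" if "i \<le> n" "?X i = 1 - q" for i
    using that
  proof (induction i)
    case 0
    then show ?case by (simp add: d_def)
  next
    case (Suc i)
    show ?case
    proof (cases "?X (Suc i) = s * ?X i - c * (1 - m i)")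
      case False
      then show ?thesis using Suc.prems v unfolding d_Suc by simp
    next
      case True
      have Xi: "1 - q \<le> ?X i" using tutte_polytope_lower[OF xT, of i] Suc.prems by simp
      show ?thesis
      proof (cases "q = 0")
        case q: True
        then have "c = 0" by (simp add: c_eq)
        then have "1 = s * ?X i" using True Suc.prems q by simp
        moreover have "s * 1 \<le> s * ?X i"
          using Xi q s_gt_1 by (intro mult_left_mono) auto
        ultimately show ?thesis using s_gt_1 by simp
      next
        case False
        then have q: "q > 0" using q_ge_0 by simp
        have "s * (?X i - (1 - q)) + c * (m i - (1 - q)) = 0"
          using True Suc.prems c_mult_q[OF q] by (simp add: s_eq algebra_simps)
        moreover have "0 \<le> s * (?X i - (1 - q))" "0 \<le> c * (m i - (1 - q))"
          using Xi m_low[of i] Suc.prems s_gt_1 c_ge_0 by auto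
        ultimately have "s * (?X i - (1 - q)) = 0" "c * (m i - (1 - q)) = 0"
          by linarith+
        then have eqs: "?X i = 1 - q" "m i = 1 - q"
          using s_gt_1 c_pos[OF q] by auto
        then have "d i = 0" using Suc by simp
        then show ?thesis using True eqs v unfolding d_Suc by simp
      qed
    qed
  qed
  have "d (Suc k) = 0"
  proof (rule extreme_point_rigid[OF x])
    show "d 0 = 0" by (simp add: d_def)
    show "1 \<le> Suc k" "Suc k \<le> n" using k by auto
    show "d i = 0" if "1 \<le> i" "i \<le> n" "?X i = 1 - q" for i
      using low that by simp
  next
    fix i j
    assume ij: "i < n" "j \<le> i" and tight: "?X (Suc i) = s * ?X i - c * (1 - ?X j)"
    have "c * m i \<le> c * ?X j"
      using m_le[OF ij(2)] c_ge_0 by (intro mult_left_mono)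
    then have eq: "?X (Suc i) = s * ?X i - c * (1 - m i)" and cm: "c * m i = c * ?X j"
      using upper[OF ij(1)] tight unfolding right_diff_distrib by linarith+
    \<comment> \<open>For \<open>c \<noteq> 0\<close> tightness makes \<open>?X j\<close> the
      running minimum. It remains to see that it moves as \<open>level_direction\<close> presumes:
      with speed \<open>1\<close> if its value is \<open>v\<close>, and not at all
      otherwise.\<close>
    have "c * d j = c * of_bool (m i = v)"
    proof (cases "c = 0")
      case False
      then have q: "q > 0" using q_ge_0 by (cases "q = 0") (auto simp: c_eq)
      have mi: "m i = ?X j" using cm False by simp
      have "d j = of_bool (?X j = v)"
      proof (cases j)
        case 0
        then show ?thesis using v by (simp add: d_def)
      next
        case (Suc j')
        show ?thesis
        proof (cases "?X (Suc j') = s * ?X j' - c * (1 - m j')")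
          case False
          then show ?thesis unfolding Suc d_Suc by simp
        next
          case True
          \<comment> \<open>Here \<open>1 - q\<close> acts as a repelling fixed point: a coordinate
            at its upper bound can be at most the earlier minimum \<open>m j'\<close> only if it
            equals \<open>1 - q\<close>, and then \<open>low\<close> applies.\<close>
          have "m i \<le> m j'"
            unfolding m_def using m_le[of _ i, unfolded m_def] Suc ij
            by (intro running_min_greatest) auto
          then have "?X j \<le> m j'" using mi by simp
          moreover have "s * m j' \<le> s * ?X j'"
            using m_le[of j' j'] s_gt_1 by (intro mult_left_mono) auto
          ultimately have "s * m j' - c * (1 - m j') \<le> m j'"
            using True Suc by simp
          then have "(t + c) * (m j' - (1 - q)) \<le> 0"
            using c_mult_q[OF q] by (simp add: s_eq algebra_simps)
          then have "m j' \<le> 1 - q"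
            using t_pos c_ge_0 by (simp add: mult_le_0_iff)
          then have "?X j = 1 - q"
            using \<open>?X j \<le> m j'\<close> tutte_polytope_lower[OF xT, of j] ij by simp
          then show ?thesis using low[of j] ij v by simp
        qed
      qed
      then show ?thesis using mi by simp
    qed simp
    moreover have "d (Suc i) = s * d i + c * of_bool (m i = v)"
      unfolding d_Suc using eq by (simp only: if_True simp_thms)
    ultimately show "d (Suc i) = s * d i + c * d j" by (simp only:)
  qed
  \<comment> \<open>The coordinate \<open>Suc k\<close> is slack and has value \<open>v\<close>, so
    \<open>d (Suc k)\<close> is \<open>1\<close> by definition.\<close>
  then show False using slack unfolding d_Suc m_def v_def by simp
qed

text \<open>The running minimum is \<open>1\<close>, attained at index \<open>0\<close>, so the
  upper bound reduces to \<open>s * coord e x i\<close>.\<close>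

lemma extreme_point_step:
  assumes x: "x extreme_point_of tutte_polytope n e q t" and i: "i < n"
    and ge: "\<And>j. j \<le> i \<Longrightarrow> coord e x j \<ge> 1"
  shows "coord e x (Suc i) \<in> {1, 1 - q, s * coord e x i}"
proof -
  have "running_min (coord e x) i = 1"
    using running_min_le[of 0 i "coord e x"] running_min_greatest[of i 1 "coord e x"] ge by force
  then show ?thesis
    using extreme_point_slack_values[OF x i] by auto
qed

text \<open>Values stay at least \<open>1\<close> until \<open>1 - q\<close> first occurs, which is
  then absorbing. At \<open>q = 0\<close> the value \<open>1 - q\<close> is itself \<open>1\<close>
  and belongs to the first alternative.\<close>

lemma extreme_point_cases:
  assumes x: "x extreme_point_of tutte_polytope n e q t" and "i \<le> n"
  shows "(\<forall>j\<le>i. coord e x j \<ge> 1) \<or> (q > 0 \<and> coord e x i = 1 - q)"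
  using \<open>i \<le> n\<close>
proof (induction i)
  case (Suc i)
  have xT: "x \<in> tutte_polytope n e q t"
    using x by (simp add: extreme_point_of_def)
  consider "\<forall>j\<le>i. coord e x j \<ge> 1" | "q > 0" "coord e x i = 1 - q"
    using Suc by auto
  then show ?case
  proof cases
    case 1
    then have "1 * 1 \<le> s * coord e x i"
      using s_gt_1 by (intro mult_mono) auto
    then have "coord e x (Suc i) \<ge> 1 \<or> (q > 0 \<and> coord e x (Suc i) = 1 - q)"
      using extreme_point_step[OF x, of i] 1 Suc.prems q_ge_0 by force
    then show ?thesis using 1 by (auto simp: le_Suc_eq simp del: coord_Suc)
  next
    case 2
    then show ?thesis using fixed_point_absorbing[OF xT 2, of "Suc i"] Suc.prems by simp
  qed
qed simp

text \<open>A last \<open>1\<close> before the final block of values \<open>1 - q\<close> could be moved alone.\<close>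

lemma extreme_point_last_one:
  assumes x: "x extreme_point_of tutte_polytope n e q t" and q: "q > 0"
    and k: "1 \<le> k" "k \<le> n" and one: "coord e x k = 1"
    and last: "k < n \<Longrightarrow> coord e x (Suc k) = 1 - q"
  shows False
proof -
  let ?X = "coord e x"
  define d :: "nat \<Rightarrow> real" where "d i = of_bool (i = k)" for i
  have xT: "x \<in> tutte_polytope n e q t"
    using x by (simp add: extreme_point_of_def)
  have ge: "?X j \<ge> 1" if "j \<le> k" for j
    using extreme_point_cases[OF x k(2)] one q that by auto
  have "d k = 0"
  proof (rule extreme_point_rigid[OF x _ _ _ k])
    show "d 0 = 0" using k by (simp add: d_def)
    show "d i = 0" if "?X i = 1 - q" for i
      using that one q by (auto simp: d_def)
  next
    fix i j
    assume ij: "i < n" "j \<le> i" and tight: "?X (Suc i) = s * ?X i - c * (1 - ?X j)"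
    \<comment> \<open>This rules out tight upper bounds on the coordinates \<open>k\<close> and
      \<open>Suc k\<close>, whose values \<open>1\<close> and \<open>1 - q\<close> lie below
      \<open>s\<close>.\<close>
    have above: "s \<le> ?X (Suc i)" if "i \<le> k"
    proof -
      have "s * 1 \<le> s * ?X i"
        using ge[OF that] s_gt_1 by (intro mult_left_mono) auto
      moreover have "c * (1 - ?X j) \<le> 0"
        using ge[of j] that ij c_ge_0 by (simp add: mult_le_0_iff)
      ultimately show ?thesis using tight by simp
    qed
    consider "Suc i < k" | "Suc i = k" | "i = k" | "k < i" by linarith
    then show "d (Suc i) = s * d i + c * d j"
    proof cases
      case 1
      then show ?thesis using ij by (simp add: d_def)
    next
      case 2
      then show ?thesis using above one s_gt_1 by auto
    next
      case 3
      then show ?thesis using above last ij s_gt_1 q by auto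
    next
      case 4
      have "?X i = 1 - q" "?X (Suc i) = 1 - q"
        using fixed_point_absorbing[OF xT q, of "Suc k"] last 4 ij by (auto simp del: coord_Suc)
      have "j \<noteq> k"
      proof
        assume "j = k"
        then have "1 - q = s * (1 - q)"
          using tight one \<open>?X i = 1 - q\<close> \<open>?X (Suc i) = 1 - q\<close> by simp
        then have "t * (1 - q) = 0" by (simp add: s_eq algebra_simps)
        then show False using t_pos q_less_1 by simp
      qed
      then show ?thesis using 4 by (simp add: d_def)
    qed
  qed
  then show False by (simp add: d_def)
qed

text \<open>The preimage \<open>y\<close> is found by turning every \<open>1 - q\<close> back into
  \<open>1\<close>. For \<open>q > 0\<close>, its trailing ones must be exactly the positions where
  \<open>x\<close> has \<open>1 - q\<close>, which holds because no genuine \<open>1\<close> of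
  \<open>x\<close> can precede that block directly or end the vector.\<close>

lemma extreme_point_in_tutte_points:
  assumes x: "x extreme_point_of tutte_polytope n e q t"
  shows "x \<in> tutte_points n e q t"
proof -
  let ?X = "coord e x"
  have xT: "x \<in> tutte_polytope n e q t"
    using x by (simp add: extreme_point_of_def)
  define y where "y = vec_of_seq (\<lambda>i. if ?X i = 1 - q then 1 else ?X i)"
  let ?Y = "coord e y"
  have Y: "?Y i = (if ?X i = 1 - q then 1 else ?X i)" if "i \<le> n" for i
    using that coord_vec_of_seq[of i] by (cases "i = 0") (auto simp: y_def)
  have ge: "?X j \<ge> 1" if "i \<le> n" "?X i \<noteq> 1 - q" "j \<le> i" for i j
    using extreme_point_cases[OF x that(1)] that by auto
  have "y \<in> cayley_points n e t"
    unfolding cayley_points_iff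
  proof (intro allI impI)
    fix i assume i: "i < n"
    show "?Y (Suc i) = 1 \<or> ?Y (Suc i) = s * ?Y i"
    proof (cases "?X (Suc i) = 1 - q")
      case True
      then show ?thesis using Y[of "Suc i"] i by simp
    next
      case False
      then have "?X j \<ge> 1" if "j \<le> i" for j
        using ge[of "Suc i" j] that i by simp
      then have "?X (Suc i) \<in> {1, s * ?X i}" "?X i \<ge> 1"
        using extreme_point_step[OF x i] False by auto
      moreover have "?Y i = ?X i"
        using Y[of i] i \<open>?X i \<ge> 1\<close> q_ge_0 by auto
      ultimately show ?thesis using Y[of "Suc i"] i False by auto
    qed
  qed
  moreover have "replace_trailing_ones n e q y = x"
  proof (rule vec_eq_coordI)
    fix i assume i: "1 \<le> i" "i \<le> n"
    note V = coord_replace_trailing_ones[OF i, of y]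
    show "coord e (replace_trailing_ones n e q y) i = ?X i"
    proof (cases "q = 0")
      case True
      then show ?thesis using V Y[OF i(2)] i by auto
    next
      case False
      then have q: "q > 0" using q_ge_0 by simp
      have "(\<forall>l\<in>{i..n}. ?Y l = 1) \<longleftrightarrow> ?X i = 1 - q"
      proof
        assume "?X i = 1 - q"
        then have "?X l = 1 - q" if "l \<in> {i..n}" for l
          using fixed_point_absorbing[OF xT q] that by auto
        then show "\<forall>l\<in>{i..n}. ?Y l = 1" using Y by auto
      next
        assume ones: "\<forall>l\<in>{i..n}. ?Y l = 1"
        show "?X i = 1 - q"
        proof (rule ccontr)
          assume neq: "?X i \<noteq> 1 - q"
          \<comment> \<open>A genuine \<open>1\<close> at \<open>i\<close> cannot be followed by
            \<open>1 - q\<close>, so it propagates up to position \<open>n\<close>, where it is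
            excluded too.\<close>
          have "?X l = 1" if "i \<le> l" "l \<le> n" for l
            using that
          proof (induction rule: dec_induct)
            case base
            then show ?case using ones neq Y[OF i(2)] i by simp
          next
            case (step l)
            then have "?X (Suc l) \<noteq> 1 - q"
              using extreme_point_last_one[OF x q, of l] i by auto
            moreover have "?Y (Suc l) = 1" using ones step.hyps(1) step.prems by (simp del: coord_Suc)
            ultimately show ?case using Y[OF step.prems] by metis
          qed
          then show False
            using extreme_point_last_one[OF x q, of n] i by auto
        qed
      qed
      then show ?thesis using V Y[OF i(2)] by simp
    qed
  qed
  ultimately show ?thesis
    unfolding tutte_points_def by force
qed

subsection \<open>The number of vertices\<close>

text \<open>Only values \<open>1\<close> are replaced, and by \<open>1 - q \<le> 1\<close>. The set
  of positions above \<open>1\<close> thus survives and can label the points.\<close>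

lemma tutte_points_gt_1_iff:
  assumes "x \<in> cayley_points n e t" "1 \<le> i" "i \<le> n"
  shows "coord e (replace_trailing_ones n e q x) i > 1 \<longleftrightarrow> coord e x i > 1"
  using assms q_ge_0 coord_replace_trailing_ones[of i x] by auto

text \<open>A coordinate above \<open>1\<close> must be \<open>s\<close> times its predecessor and
  any other is \<open>1\<close>, so the label determines the point recursively.\<close>

lemma cayley_points_eqI:
  assumes x: "x \<in> cayley_points n e t" and y: "y \<in> cayley_points n e t"
    and eq: "\<And>i. 1 \<le> i \<Longrightarrow> i \<le> n \<Longrightarrow> coord e x i > 1 \<longleftrightarrow> coord e y i > 1"
  shows "x = y"
proof (rule vec_eq_coordI)
  have gt: "coord e z (Suc i) = (if coord e z (Suc i) > 1 then s * coord e z i else 1)"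
    if "z \<in> cayley_points n e t" "i < n" for z i
    using that cayley_points_ge_1[OF that(1), of "Suc i"] unfolding cayley_points_iff by force
  fix i assume "i \<le> n"
  then show "coord e x i = coord e y i"
  proof (induction i)
    case (Suc i)
    then have "coord e x i = coord e y i" "coord e x (Suc i) > 1 \<longleftrightarrow> coord e y (Suc i) > 1"
      using eq[of "Suc i"] by auto
    then show ?case
      using gt[OF x, of i] gt[OF y, of i] Suc.prems by (metis Suc_le_lessD)
  qed simp
qed

text \<open>Multiply by \<open>s\<close> at the positions in \<open>S\<close> and reset to
  \<open>1\<close> elsewhere; as all values are at least \<open>1\<close>, each product is at least
  \<open>s > 1\<close>.\<close>

lemma cayley_point_of_subset:
  assumes "S \<subseteq> {1..n}"
  obtains x where "x \<in> cayley_points n e t" "{i\<in>{1..n}. coord e x i > 1} = S"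
proof -
  define z :: "nat \<Rightarrow> real" where "z = rec_nat 1 (\<lambda>i a. if Suc i \<in> S then s * a else 1)"
  have z0: "z 0 = 1" and zS: "z (Suc i) = (if Suc i \<in> S then s * z i else 1)" for i
    by (simp_all add: z_def)
  have Z: "coord e (vec_of_seq z) i = z i" if "i \<le> n" for i
    using that coord_vec_of_seq[of i z] z0 by (cases "i = 0") auto
  have x: "vec_of_seq z \<in> cayley_points n e t"
    unfolding cayley_points_iff by (auto simp: Z zS simp del: coord_Suc)
  have "z i > 1 \<longleftrightarrow> i \<in> S" if "i \<in> {1..n}" for i
  proof -
    obtain j where j: "i = Suc j" using \<open>i \<in> {1..n}\<close> by (cases i) auto
    have "z j \<ge> 1" using cayley_points_ge_1[OF x, of j] Z[of j] that j by simp
    then have "s * 1 \<le> s * z j" using s_gt_1 by (intro mult_left_mono) auto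
    then have "s * z j > 1" using s_gt_1 by linarith
    then show ?thesis by (simp add: j zS)
  qed
  then have "{i\<in>{1..n}. coord e (vec_of_seq z) i > 1} = S"
    using assms Z by auto
  then show ?thesis using that x by blast
qed

text \<open>The label map \<open>h\<close> is a bijection from the points onto the subsets of
  \<open>{1..n}\<close>.\<close>

lemma card_tutte_points: "card (tutte_points n e q t) = 2 ^ n"
proof -
  define h where "h v = {i\<in>{1..n}. coord e v i > 1}" for v :: "real ^ 'n"
  have h: "h (replace_trailing_ones n e q x) = h x" if "x \<in> cayley_points n e t" for x
    unfolding h_def using tutte_points_gt_1_iff[OF that] by auto
  have inj: "x = y" if "x \<in> cayley_points n e t" "y \<in> cayley_points n e t" "h x = h y" for x y
    using that(3) by (intro cayley_points_eqI[OF that(1,2)]) (auto simp: h_def)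
  have "inj_on h (tutte_points n e q t)"
  proof (rule inj_onI)
    fix v w
    assume "v \<in> tutte_points n e q t" "w \<in> tutte_points n e q t" and eq: "h v = h w"
    then obtain x y where xy: "x \<in> cayley_points n e t" "y \<in> cayley_points n e t"
        "v = replace_trailing_ones n e q x" "w = replace_trailing_ones n e q y"
      by (auto simp: tutte_points_def)
    then have "x = y" using eq h by (intro inj) auto
    then show "v = w" using xy by simp
  qed
  moreover have "h ` tutte_points n e q t = Pow {1..n}"
  proof
    show "h ` tutte_points n e q t \<subseteq> Pow {1..n}" by (auto simp: h_def)
    show "Pow {1..n} \<subseteq> h ` tutte_points n e q t"
    proof
      fix S assume "S \<in> Pow {1..n}"
      then obtain x where x: "x \<in> cayley_points n e t" "h x = S"
        using cayley_point_of_subset[of S] unfolding h_def by auto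
      then show "S \<in> h ` tutte_points n e q t"
        using h[OF x(1)] unfolding tutte_points_def by blast
    qed
  qed
  ultimately have "card (tutte_points n e q t) = card (Pow {1..n})"
    by (metis card_image)
  then show ?thesis by (simp add: card_Pow)
qed

end

theorem theorem8p4:
  fixes n :: nat and e :: "nat \<Rightarrow> 'n::finite" and q t :: real
  assumes "n \<ge> 1"
    and "bij_betw e {1..n} (UNIV :: 'n set)"
    and "t > 0" and "0 \<le> q" and "q < 1"
  shows "{v. v extreme_point_of tutte_polytope n e q t} = tutte_points n e q t \<and>
         card {v. v extreme_point_of tutte_polytope n e q t} = 2 ^ n"
proof -
  interpret tutte_parameters n e q t "1 + t" "t * (1 - q) / q"
    using assms by unfold_locales auto
  have "{v. v extreme_point_of tutte_polytope n e q t} = tutte_points n e q t"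
    using extreme_point_in_tutte_points tutte_points_extreme unfolding tutte_points_def by blast
  then show ?thesis using card_tutte_points by simp
qed

end
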